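(* Let $m,d\ge1$ be integers and $\nu:=m/d$. Let $\mathcal X$ be any finite set, $\mathcal Y:=\{-1,1\}$, $\mathcal H\subseteq\mathcal Y^{\mathcal X}$ any hypothesis class of VC dimension $d$, and $L\colon(\mathcal X\times\mathcal Y)^m\to\mathcal H$ any learning algorithm. (i) If $\nu\ge12.8$, then there is a probability distribution $D$ on $\mathcal X\times\mathcal Y$ such that $$\mathsf P\Big(\Delta\big(L(Z_m^D),D\big)>\frac1{\sqrt{320\,\nu}}\Big)\ge0.238.$$ (ii) If $\nu\ge12.8$, then there is a probability distribution $D$ on $\mathcal X\times\mathcal Y$ such that $$\mathsf P\Big(\Delta\big(L(Z_m^D),D\big)>\frac1{\sqrt{41.3\,\nu}}\Big)\ge\frac1{64}.$$ (iii) If $\nu\ge3$, then there is a probability distribution $D$ on $\mathcal X\times\mathcal Y$ such that $$\mathsf P\Big(\Delta\big(L(Z_m^D),D\big)>\frac1{\sqrt{320\,\nu}}\Big)\ge0.227,$$ and there is a probability distribution $D$ on $\mathcal X\times\mathcal Y$ such that $$\mathsf P\Big(\Delta\big(L(Z_m^D),D\big)>\frac1{\sqrt{49.6\,\nu}}\Big)\ge\frac1{64}.$$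
   Context: For a probability distribution $D$ on $\mathcal X\times\mathcal Y$, let $(X^D,Y^D)$ be a random pair with distribution $D$, and let $Z_m^D:=\big((X_1^D,Y_1^D),\dots,(X_m^D,Y_m^D)\big)$ be a sequence of $m$ independent copies of it. For $h\in\mathcal H$ put $\operatorname{err}(h,D):=\mathsf P(h(X^D)\ne Y^D)$; the excess risk of $h$ is $\Delta(h,D):=\operatorname{err}(h,D)-\min_{g\in\mathcal H}\operatorname{err}(g,D)$. The VC dimension of $\mathcal H$ is the largest nonnegative integer $k$ such that some $k$-element subset $\mathcal X_0$ of $\mathcal X$ is shattered by $\mathcal H$, i.e. the set of restrictions to $\mathcal X_0$ of the functions in $\mathcal H$ equals $\mathcal Y^{\mathcal X_0}$. *)

theory Defs
  imports "HOL-Probability.Probability"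
begin

definition labels :: "int set" where
  "labels = {-1, 1}"

text \<open>
  Hypotheses on a domain \<open>X\<close> are the extensional functions in
  \<open>X \<rightarrow>\<^sub>E labels\<close>.  Since \<open>X\<close> and \<open>labels\<close> are finite, every probability distribution on
  their product is a \<open>pmf\<close> supported in \<open>X \<times> labels\<close>.
\<close>

definition distributions_on :: "'x set \<Rightarrow> ('x \<times> int) pmf set" where
  "distributions_on X = {D. set_pmf D \<subseteq> X \<times> labels}"

text \<open>The \<open>m\<close>-fold power of \<open>X \<times> labels\<close>; tuples are lists of length \<open>m\<close>.\<close>

definition samples :: "nat \<Rightarrow> 'x set \<Rightarrow> ('x \<times> int) list set" where
  "samples m X = {z. length z = m \<and> set z \<subseteq> X \<times> labels}"

definition err :: "('x \<Rightarrow> int) \<Rightarrow> ('x \<times> int) pmf \<Rightarrow> real" where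
  "err h D = measure_pmf.prob D {(x, y). h x \<noteq> y}"

text \<open>The minimum is used only for classes \<open>H\<close> that are finite and nonempty.\<close>

definition excess_risk ::
    "('x \<Rightarrow> int) set \<Rightarrow> ('x \<Rightarrow> int) \<Rightarrow> ('x \<times> int) pmf \<Rightarrow> real" where
  "excess_risk H h D = err h D - Min ((\<lambda>g. err g D) ` H)"

definition shatters :: "('x \<Rightarrow> int) set \<Rightarrow> 'x set \<Rightarrow> bool" where
  "shatters H S \<longleftrightarrow> (\<lambda>h. restrict h S) ` H = (S \<rightarrow>\<^sub>E labels)"

text \<open>
  A relation rather than a function: the empty class shatters no set, not even the empty
  one, and so has no VC dimension.
\<close>

definition has_vc_dim :: "'x set \<Rightarrow> ('x \<Rightarrow> int) set \<Rightarrow> nat \<Rightarrow> bool" where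
  "has_vc_dim X H d \<longleftrightarrow>
     (\<exists>S. S \<subseteq> X \<and> finite S \<and> card S = d \<and> shatters H S) \<and>
     (\<forall>S. S \<subseteq> X \<and> finite S \<and> shatters H S \<longrightarrow> card S \<le> d)"

end

theory Submission
  imports Defs
begin

text \<open>
  Let \<open>S\<close> be a shattered set of size \<open>d\<close>. For a sign pattern \<open>\<sigma>\<close> on \<open>S\<close> let \<open>D\<^sub>\<sigma>\<close> choose \<open>x\<close> uniformly
  in \<open>S\<close> and label it \<open>\<sigma> x\<close> with probability \<open>(1 + \<gamma>) / 2\<close>. Then the excess risk of \<open>h\<close> is \<open>\<gamma>\<close> times the
  fraction \<open>U\<close> of points of \<open>S\<close> at which \<open>h\<close> and \<open>\<sigma>\<close> disagree. If \<open>\<sigma>\<close> is uniformly random, the mean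
  of \<open>U\<close> is at least the mean Bayes error \<open>p\<close> of recovering one sign from the labels seen at its point,
  and as \<open>U \<le> 1\<close>, \<open>U > u\<close> with probability at least \<open>(p - u) / (1 - u)\<close> for some \<open>\<sigma>\<close>.

  The Bayes error from \<open>n\<close> labels is \<open>1/2 - \<gamma>/2 \<Sum>\<^sub>j e\<^sub>j\<close>, summed over \<open>2j < n\<close>, with \<open>e\<^sub>j\<close> nonincreasing;
  hence it lies above each secant line through consecutive odd \<open>n\<close>, and by linearity its mean is at
  least the value of that line at the mean \<open>\<nu> = m / d\<close> of \<open>n\<close>. Take \<open>\<gamma> = sqrt (C / \<nu>)\<close>.
\<close>

section \<open>Central binomial coefficients\<close>

text \<open>The probability that a simple symmetric random walk is back at its origin after
  \<open>2 * k\<close> steps. Times \<open>(1 - \<gamma>\<^sup>2) ^ k\<close> it is the probability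
  that \<open>2 * k\<close> labels of bias \<gamma> are tied.\<close>

definition return_prob :: "nat \<Rightarrow> real" where
  "return_prob k = real ((2 * k) choose k) / 4 ^ k"

lemma return_prob_0: "return_prob 0 = 1"
  by (simp add: return_prob_def)

lemma return_prob_pos: "return_prob k > 0"
  by (simp add: return_prob_def)

lemma return_prob_Suc: "return_prob (Suc k) = return_prob k * (2 * real k + 1) / (2 * real k + 2)"
proof -
  have "Suc k * (Suc (Suc (2 * k)) choose Suc k) = Suc (Suc (2 * k)) * (Suc (2 * k) choose k)"
    by (rule Suc_times_binomial)
  then have "Suc k * (2 * Suc k choose Suc k) = Suc k * (2 * (Suc (2 * k) choose k))"
    by (simp del: binomial_Suc_Suc add: algebra_simps)
  then have "2 * Suc k choose Suc k = 2 * (Suc (2 * k) choose k)"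
    by (simp only: mult_cancel1) simp
  then have 1: "real (2 * Suc k choose Suc k) = 2 * real (Suc (2 * k) choose k)"
    by (simp only: of_nat_mult of_nat_numeral)
  have "Suc k * (Suc (2 * k) choose Suc k) = Suc (2 * k) * (2 * k choose k)"
    by (rule Suc_times_binomial)
  moreover have "Suc (2 * k) choose Suc k = Suc (2 * k) choose k"
    using binomial_symmetric[of k "Suc (2 * k)"] by (simp add: Suc_diff_le del: binomial_Suc_Suc)
  ultimately have "(real k + 1) * real (Suc (2 * k) choose k) = (2 * real k + 1) * real (2 * k choose k)"
    by (metis of_nat_Suc of_nat_mult of_nat_numeral add.commute)
  then have 2: "real (Suc (2 * k) choose k) = (2 * real k + 1) * real (2 * k choose k) / (real k + 1)"
    by (simp add: field_simps)
  show ?thesis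
    unfolding return_prob_def 1 2 by (simp add: divide_simps)
qed

lemma return_prob_antimono: "return_prob (Suc k) \<le> return_prob k"
  using return_prob_pos[of k] by (simp add: return_prob_Suc field_simps)

text \<open>By the rational ratio in \<open>return_prob_Suc\<close>, sums weighted by falling
  factorials of \<open>j\<close> telescope. Here and in the next two lemmas they are multiples of
  the same \<open>return_prob k\<close>, so one bound on it will control all orders of an expansion
  in \<open>g\<close>.\<close>

lemma sum_return_prob: "(\<Sum>j<k. return_prob j) = 2 * real k * return_prob k"
  by (induction k) (simp_all add: return_prob_Suc field_simps)

lemma sum_return_prob_linear: "(\<Sum>j<k. real j * return_prob j) = 2 * real k * (real k - 1) / 3 * return_prob k"
proof (induction k)
  case (Suc k)
  show ?case
    unfolding sum.lessThan_Suc Suc return_prob_Suc by (simp add: field_simps)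
qed simp

lemma sum_return_prob_quadratic:
  "(\<Sum>j<k. real j * (real j - 1) * return_prob j) = 2 * real k * (real k - 1) * (real k - 2) / 5 * return_prob k"
proof (induction k)
  case (Suc k)
  show ?case
    unfolding sum.lessThan_Suc Suc return_prob_Suc by (simp add: field_simps)
qed simp

text \<open>
  The shift \<open>3/11\<close> is the smallest that makes the left-hand side nonincreasing from \<open>k = 2\<close> on; the
  constant is its value there, only slightly above the limit \<open>1/\<pi>\<close>.
\<close>

lemma return_prob_square_bound:
  assumes "k \<ge> 2"
  shows "(return_prob k)\<^sup>2 * (real k + 3 / 11) \<le> 225 / 704"
  using assms
proof (induction k rule: dec_induct)
  case base
  have "return_prob 2 = 3 / 8"
    using return_prob_Suc[of 1] return_prob_Suc[of 0] by (simp add: return_prob_0 numeral_2_eq_2)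
  then show ?case by (simp only:) (simp add: power2_eq_square)
next
  case (step k)
  let ?x = "real k"
  have x: "?x \<ge> 2" using step by simp
  \<comment> \<open>The right side exceeds the left by \<open>(k - 2) / 11\<close>.\<close>
  have "(2 * ?x + 1)\<^sup>2 * (?x + 14 / 11) \<le> (2 * ?x + 2)\<^sup>2 * (?x + 3 / 11)"
    using x by (simp add: power2_eq_square algebra_simps)
  then have "(2 * ?x + 1)\<^sup>2 * (?x + 14 / 11) / (2 * ?x + 2)\<^sup>2 \<le> ?x + 3 / 11"
    using x by (simp add: divide_le_eq mult.commute)
  then have "(return_prob k)\<^sup>2 * ((2 * ?x + 1)\<^sup>2 * (?x + 14 / 11) / (2 * ?x + 2)\<^sup>2) \<le> (return_prob k)\<^sup>2 * (?x + 3 / 11)"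
    by (rule mult_left_mono) simp
  moreover have "(return_prob (Suc k))\<^sup>2 * (real (Suc k) + 3 / 11) =
      (return_prob k)\<^sup>2 * ((2 * ?x + 1)\<^sup>2 * (?x + 14 / 11) / (2 * ?x + 2)\<^sup>2)"
    by (simp add: return_prob_Suc power_mult_distrib power_divide add.commute)
  ultimately show ?case using step.IH by linarith
qed

text \<open>Cutting the binomial expansion after an even order overestimates. In the induction,
  Bernoulli's inequality bounds the subtracted part from below.\<close>

lemma power_one_minus_le_quadratic:
  fixes g :: real
  assumes "0 \<le> g" "g \<le> 1"
  shows "(1 - g) ^ j \<le> 1 - real j * g + real j * (real j - 1) / 2 * g\<^sup>2"
proof (induction j)
  case (Suc j)
  have b: "1 - real j * g \<le> (1 - g) ^ j"
    using Bernoulli_inequality[of "- g" j] assms by simp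
  have "(1 - g) ^ Suc j = (1 - g) ^ j - g * (1 - g) ^ j"
    by (simp add: algebra_simps)
  also have "\<dots> \<le> (1 - real j * g + real j * (real j - 1) / 2 * g\<^sup>2) - g * (1 - real j * g)"
    using Suc mult_left_mono[OF b assms(1)] by linarith
  also have "\<dots> = 1 - real (Suc j) * g + real (Suc j) * (real (Suc j) - 1) / 2 * g\<^sup>2"
    by (simp add: field_simps power2_eq_square)
  finally show ?case .
qed simp

lemma sum_return_prob_power_le:
  fixes g :: real
  assumes "0 \<le> g" "g \<le> 1"
  shows "(\<Sum>j<k. return_prob j * (1 - g) ^ j) \<le>
    2 * real k * return_prob k * (1 - (real k - 1) / 3 * g + (real k - 1) * (real k - 2) / 10 * g\<^sup>2)"
proof -
  have "(\<Sum>j<k. return_prob j * (1 - g) ^ j) \<le>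
      (\<Sum>j<k. return_prob j * (1 - real j * g + real j * (real j - 1) / 2 * g\<^sup>2))"
    using power_one_minus_le_quadratic[OF assms] return_prob_pos
    by (intro sum_mono mult_left_mono) (auto intro: less_imp_le)
  also have "\<dots> = (\<Sum>j<k. return_prob j) - (\<Sum>j<k. real j * return_prob j) * g
      + (\<Sum>j<k. real j * (real j - 1) * return_prob j) * (g\<^sup>2 / 2)"
    unfolding sum_distrib_right sum_subtractf[symmetric] sum.distrib[symmetric]
    by (intro sum.cong) (simp_all add: field_simps)
  also have "\<dots> = 2 * real k * return_prob k *
      (1 - (real k - 1) / 3 * g + (real k - 1) * (real k - 2) / 10 * g\<^sup>2)"
    unfolding sum_return_prob sum_return_prob_linear sum_return_prob_quadratic by (simp add: field_simps)
  finally show ?thesis .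
qed

section \<open>Testing a sign from noisy samples\<close>

text \<open>
  \<open>a\<close> and \<open>b\<close> are the likelihoods of the data so far under the two hypotheses. One more label, of bias
  \<open>\<gamma>\<close> towards the true sign, turns a functional \<open>f\<close> of them into \<open>sample_step \<gamma> f\<close>. For \<open>f = min\<close>
  the \<open>n\<close>-th iterate at \<open>(1, 1)\<close> is twice the Bayes error of the test from \<open>n\<close> labels.
\<close>

definition sample_step :: "real \<Rightarrow> (real \<Rightarrow> real \<Rightarrow> real) \<Rightarrow> real \<Rightarrow> real \<Rightarrow> real" where
  "sample_step \<gamma> f a b =
     f (a * ((1 + \<gamma>) / 2)) (b * ((1 - \<gamma>) / 2)) + f (a * ((1 - \<gamma>) / 2)) (b * ((1 + \<gamma>) / 2))"

lemma sample_step_linear: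
  "sample_step \<gamma> (\<lambda>a b. x * f a b + y * g a b) = (\<lambda>a b. x * sample_step \<gamma> f a b + y * sample_step \<gamma> g a b)"
  by (simp add: fun_eq_iff sample_step_def distrib_left)

text \<open>Pascal's rule, arranged for induction on the number of labels.\<close>

lemma sum_choose_Suc:
  fixes F :: "nat \<Rightarrow> real"
  shows "(\<Sum>k\<le>Suc n. real (Suc n choose k) * F k) = (\<Sum>k\<le>n. real (n choose k) * (F (Suc k) + F k))"
proof -
  have "(\<Sum>k\<le>Suc n. real (n choose k) * F k) = F 0 + (\<Sum>k\<le>n. real (n choose Suc k) * F (Suc k))"
    by (subst sum.atMost_Suc_shift) simp
  moreover have "(\<Sum>k\<le>Suc n. real (n choose k) * F k) = (\<Sum>k\<le>n. real (n choose k) * F k)"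
    by simp
  moreover have "(\<Sum>k\<le>Suc n. real (Suc n choose k) * F k) =
      F 0 + (\<Sum>k\<le>n. real (n choose k) * F (Suc k)) + (\<Sum>k\<le>n. real (n choose Suc k) * F (Suc k))"
    by (subst sum.atMost_Suc_shift) (simp add: sum.distrib algebra_simps)
  ultimately show ?thesis
    by (simp add: sum.distrib algebra_simps)
qed

text \<open>The likelihoods depend on \<open>n\<close> labels only through the number
  \<open>k\<close> of those that favour the first sign, and \<open>n choose k\<close> label
  sequences share it.\<close>

lemma sample_step_funpow:
  fixes \<gamma> :: real
  defines "p \<equiv> (1 + \<gamma>) / 2" and "q \<equiv> (1 - \<gamma>) / 2"
  shows "(sample_step \<gamma> ^^ n) f a b =
    (\<Sum>k\<le>n. real (n choose k) * f (a * (p ^ k * q ^ (n - k))) (b * (q ^ k * p ^ (n - k))))"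
proof (induction n arbitrary: f)
  case (Suc n)
  let ?F = "\<lambda>k. f (a * (p ^ k * q ^ (Suc n - k))) (b * (q ^ k * p ^ (Suc n - k)))"
  have "(sample_step \<gamma> ^^ Suc n) f a b = (sample_step \<gamma> ^^ n) (sample_step \<gamma> f) a b"
    by (simp add: funpow_swap1)
  also have "\<dots> = (\<Sum>k\<le>n. real (n choose k) * (?F (Suc k) + ?F k))"
    unfolding Suc
    by (intro sum.cong) (auto simp: sample_step_def p_def[symmetric] q_def[symmetric] Suc_diff_le mult_ac)
  also have "\<dots> = (\<Sum>k\<le>Suc n. real (Suc n choose k) * ?F k)"
    by (rule sum_choose_Suc[symmetric])
  finally show ?case .
qed simp

text \<open>A further label helps only when the labels seen so far are tied.\<close>

lemma min_minus_sample_step: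
  fixes \<gamma> :: real
  assumes "0 \<le> \<gamma>" "\<gamma> \<le> 1"
  defines "p \<equiv> (1 + \<gamma>) / 2" and "q \<equiv> (1 - \<gamma>) / 2"
  shows "min (p ^ k * q ^ l) (q ^ k * p ^ l) - sample_step \<gamma> min (p ^ k * q ^ l) (q ^ k * p ^ l) =
    (if k = l then \<gamma> * (p * q) ^ k else 0)"
proof -
  have pq: "0 \<le> q" "q \<le> p" "p + q = 1" "p - q = \<gamma>"
    using assms by (auto simp: p_def q_def field_simps)
  \<comment> \<open>The smaller likelihood belongs to the sign backed by fewer labels.\<close>
  have less: "min (p ^ i * q ^ j) (q ^ i * p ^ j) = q ^ i * p ^ j" if ji: "j \<le> i" for i j
  proof -
    obtain n where n: "i = j + n" using le_Suc_ex[OF ji] by blast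
    have "(p * q) ^ j * q ^ n \<le> (p * q) ^ j * p ^ n"
      using pq by (simp add: mult_left_mono power_mono)
    then show ?thesis by (simp add: n power_add power_mult_distrib mult_ac min_def)
  qed
  have st: "sample_step \<gamma> min (p ^ i * q ^ j) (q ^ i * p ^ j) =
      min (p ^ Suc i * q ^ j) (q ^ Suc i * p ^ j) + min (p ^ i * q ^ Suc j) (q ^ i * p ^ Suc j)" for i j
    by (simp add: sample_step_def p_def[symmetric] q_def[symmetric] mult_ac)
  consider "k = l" | "l < k" | "k < l" by linarith
  then show ?thesis
  proof cases
    \<comment> \<open>Either next label breaks the tie and leaves \<open>q * (p * q) ^ k\<close> as
      the smaller likelihood.\<close>
    case 1
    have "min (p ^ k * q ^ Suc k) (q ^ k * p ^ Suc k) = p ^ k * q ^ Suc k"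
      using less[of k "Suc k"] by (simp add: min.commute mult_ac)
    then have "min (p ^ k * q ^ l) (q ^ k * p ^ l) - sample_step \<gamma> min (p ^ k * q ^ l) (q ^ k * p ^ l)
        = (p * q) ^ k * (1 - 2 * q)"
      using less[of k "Suc k"] unfolding st by (simp add: 1 power_mult_distrib algebra_simps)
    also have "1 - 2 * q = \<gamma>" using pq by linarith
    finally show ?thesis using 1 by (simp add: mult_ac)
  next
    \<comment> \<open>One label cannot reverse a lead, so the same sign attains both minima and
      \<open>p + q = 1\<close> restores the old value.\<close>
    case 2
    then have "sample_step \<gamma> min (p ^ k * q ^ l) (q ^ k * p ^ l) = q ^ k * p ^ l * (p + q)"
      unfolding st by (subst (1 2) less) (simp_all add: algebra_simps)
    then show ?thesis using 2 pq by (simp add: less)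
  next
    case 3
    have less': "min (p ^ i * q ^ j) (q ^ i * p ^ j) = p ^ i * q ^ j" if "i \<le> j" for i j
      using less[OF that] by (simp add: min.commute mult_ac)
    have "sample_step \<gamma> min (p ^ k * q ^ l) (q ^ k * p ^ l) = p ^ k * q ^ l * (p + q)"
      unfolding st using 3 by (subst (1 2) less') (simp_all add: algebra_simps)
    then show ?thesis using 3 pq by (simp add: less')
  qed
qed

text \<open>Telescoping over the labels: the one after the first \<open>n\<close> lowers the value
  only if those are tied, so only even \<open>n = 2 * j\<close> contribute, each \<gamma> times the
  probability of a tie.\<close>

lemma sample_step_funpow_min:
  fixes \<gamma> :: real
  assumes "0 \<le> \<gamma>" "\<gamma> \<le> 1"
  shows "(sample_step \<gamma> ^^ n) min 1 1 = 1 - \<gamma> * (\<Sum>j<(n + 1) div 2. return_prob j * (1 - \<gamma>\<^sup>2) ^ j)"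
proof (induction n)
  case (Suc n)
  define p q where pq: "p = (1 + \<gamma>) / 2" "q = (1 - \<gamma>) / 2"
  have "(sample_step \<gamma> ^^ n) min 1 1 - (sample_step \<gamma> ^^ Suc n) min 1 1 =
      (sample_step \<gamma> ^^ n) min 1 1 - (sample_step \<gamma> ^^ n) (sample_step \<gamma> min) 1 1"
    by (simp add: funpow_swap1)
  also have "\<dots> = (\<Sum>k\<le>n. real (n choose k) * (if k = n - k then \<gamma> * (p * q) ^ k else 0))"
    unfolding sample_step_funpow sum_subtractf[symmetric] right_diff_distrib[symmetric] mult_1
      min_minus_sample_step[OF assms] pq ..
  also have "\<dots> = (\<Sum>k\<le>n. if 2 * k = n then \<gamma> * (return_prob k * (1 - \<gamma>\<^sup>2) ^ k) else 0)"
  proof (intro sum.cong refl)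
    fix k assume "k \<in> {..n}"
    then have "k = n - k \<longleftrightarrow> 2 * k = n" by auto
    moreover have "(p * q) ^ k = (1 - \<gamma>\<^sup>2) ^ k / 4 ^ k"
    proof -
      have "p * q = (1 - \<gamma>\<^sup>2) / 4"
        by (simp add: pq power2_eq_square algebra_simps)
      then show ?thesis by (simp only: power_divide)
    qed
    ultimately show "real (n choose k) * (if k = n - k then \<gamma> * (p * q) ^ k else 0) =
        (if 2 * k = n then \<gamma> * (return_prob k * (1 - \<gamma>\<^sup>2) ^ k) else 0)"
      by (auto simp: return_prob_def)
  qed
  also have "\<dots> = \<gamma> * (\<Sum>j<(Suc n + 1) div 2. return_prob j * (1 - \<gamma>\<^sup>2) ^ j)
      - \<gamma> * (\<Sum>j<(n + 1) div 2. return_prob j * (1 - \<gamma>\<^sup>2) ^ j)"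
  proof (cases "even n")
    case True
    then obtain i where i: "n = 2 * i" by blast
    have "(\<Sum>k\<le>n. if 2 * k = n then \<gamma> * (return_prob k * (1 - \<gamma>\<^sup>2) ^ k) else 0) =
        (\<Sum>k\<le>n. if k = i then \<gamma> * (return_prob k * (1 - \<gamma>\<^sup>2) ^ k) else 0)"
      by (intro sum.cong) (auto simp: i)
    then show ?thesis by (simp add: i algebra_simps)
  next
    case False
    then have "(Suc n + 1) div 2 = (n + 1) div 2" by presburger
    moreover have "(\<Sum>k\<le>n. if 2 * k = n then \<gamma> * (return_prob k * (1 - \<gamma>\<^sup>2) ^ k) else 0) = 0"
      using False by (intro sum.neutral) auto
    ultimately show ?thesis by simp
  qed
  finally show ?case using Suc by simp
qed simp

section \<open>Affine lower bounds and a random number of labels\<close>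

text \<open>Partial sums of a nonincreasing sequence are concave in the number of terms, so they lie
  below the line through the points at \<open>k\<close> and \<open>k + 1\<close>, whose slope is
  \<open>e k\<close>.\<close>

lemma decseq_sum_le_tangent:
  fixes e :: "nat \<Rightarrow> real"
  assumes "decseq e"
  shows "sum e {..<l} \<le> sum e {..<k} + e k * (real l - real k)"
proof (cases "k \<le> l")
  case True
  then show ?thesis
  proof (induction l rule: dec_induct)
    case (step l)
    then show ?case using decseqD[OF assms, of k l] by (simp add: algebra_simps)
  qed simp
next
  case False
  then have "l \<le> k" by simp
  then show ?thesis
  proof (induction l rule: inc_induct)
    case (step l)
    then show ?case using decseqD[OF assms, of l k] by (simp add: algebra_simps)
  qed simp
qed

text \<open>For \<open>k \<ge> 1\<close> this is the secant line through the values at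
  \<open>n = 2 * k - 1\<close> and \<open>n = 2 * k + 1\<close>. At even \<open>n\<close> the
  rounding in \<open>(n + 1) div 2\<close> only helps.\<close>

lemma sample_step_funpow_min_ge:
  fixes \<gamma> :: real
  assumes "0 \<le> \<gamma>" "\<gamma> \<le> 1"
  shows "(sample_step \<gamma> ^^ n) min 1 1 \<ge>
    1 - \<gamma> * ((\<Sum>j<k. return_prob j * (1 - \<gamma>\<^sup>2) ^ j) + return_prob k * (1 - \<gamma>\<^sup>2) ^ k * (real n + 1 - 2 * real k) / 2)"
proof -
  let ?e = "\<lambda>j. return_prob j * (1 - \<gamma>\<^sup>2) ^ j"
  have g: "0 \<le> 1 - \<gamma>\<^sup>2" "1 - \<gamma>\<^sup>2 \<le> 1"
    using assms by (auto simp: power_le_one)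
  have "decseq ?e"
  proof (rule decseq_SucI)
    fix j
    have "(1 - \<gamma>\<^sup>2) ^ Suc j \<le> (1 - \<gamma>\<^sup>2) ^ j"
      using g by (intro power_decreasing) auto
    then show "?e (Suc j) \<le> ?e j"
      using g return_prob_antimono return_prob_pos[of j] by (intro mult_mono) auto
  qed
  then have "sum ?e {..<(n + 1) div 2} \<le> sum ?e {..<k} + ?e k * (real ((n + 1) div 2) - real k)"
    by (rule decseq_sum_le_tangent)
  also have "?e k * (real ((n + 1) div 2) - real k) \<le> ?e k * ((real n + 1 - 2 * real k) / 2)"
  proof (rule mult_left_mono)
    have "2 * ((n + 1) div 2) \<le> n + 1" by simp
    then have "2 * real ((n + 1) div 2) \<le> real n + 1" by linarith
    then show "real ((n + 1) div 2) - real k \<le> (real n + 1 - 2 * real k) / 2" by simp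
  qed (use g return_prob_pos[of k] in auto)
  finally show ?thesis
    unfolding sample_step_funpow_min[OF assms] using assms(1) by (simp add: mult_left_mono)
qed

text \<open>
  A letter is informative with probability \<open>r\<close>, so the number of informative letters in a word of
  length \<open>m\<close> has mean \<open>m r\<close>. An affine bound in that number therefore survives averaging; folding
  the mixture into \<open>f\<close> one letter at a time proves this without the binomial distribution.
\<close>

lemma sum_lists_ge_affine:
  fixes f :: "real \<Rightarrow> real \<Rightarrow> real" and u v :: "'w \<Rightarrow> real"
  assumes "0 \<le> r" "r \<le> 1"
    and mix: "\<And>f a b. (\<And>c a b. 0 \<le> c \<Longrightarrow> f (c * a) (c * b) = c * f a b) \<Longrightarrow>
      (\<Sum>w\<in>W. f (a * u w) (b * v w)) = (1 - r) * f a b + r * sample_step \<gamma> f a b"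
    and hom: "\<And>c a b. 0 \<le> c \<Longrightarrow> f (c * a) (c * b) = c * f a b"
    and affine: "\<And>n. A - B * real n \<le> (sample_step \<gamma> ^^ n) f 1 1"
  shows "A - B * (real m * r) \<le>
    (\<Sum>z | set z \<subseteq> W \<and> length z = m. f (prod_list (map u z)) (prod_list (map v z)))"
  using hom affine
proof (induction m arbitrary: f A)
  case 0
  have "{z. set z \<subseteq> W \<and> length z = 0} = {[]}" by auto
  then show ?case using "0.prems"(2)[of 0] by simp
next
  case (Suc m)
  let ?Z = "{z. set z \<subseteq> W \<and> length z = m}"
  let ?U = "\<lambda>z. prod_list (map u z)" and ?V = "\<lambda>z. prod_list (map v z)"
  define h where "h a b = (1 - r) * f a b + r * sample_step \<gamma> f a b" for a b
  have h_hom: "h (c * a) (c * b) = c * h a b" if "0 \<le> c" for c a b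
  proof -
    have "f (c * a * x) (c * b * y) = c * f (a * x) (b * y)" for x y
      using Suc.prems(1)[OF that, of "a * x" "b * y"] by (simp only: mult.assoc)
    then show ?thesis
      using Suc.prems(1)[OF that] by (simp only: h_def sample_step_def) (simp only: algebra_simps)
  qed
  have h_pow: "(sample_step \<gamma> ^^ n) h =
      (\<lambda>a b. (1 - r) * (sample_step \<gamma> ^^ n) f a b + r * (sample_step \<gamma> ^^ Suc n) f a b)" for n
  proof (induction n)
    case (Suc n)
    show ?case unfolding funpow.simps(2)[of n] o_apply Suc sample_step_linear by simp
  qed (simp add: h_def fun_eq_iff)
  \<comment> \<open>Passing from \<open>f\<close> to \<open>h\<close> keeps the slope and lowers the
    constant by \<open>B * r\<close>, the mean effect of one letter.\<close>
  have "(A - B * r) - B * real n \<le> (sample_step \<gamma> ^^ n) h 1 1" for n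
  proof -
    have "(1 - r) * (A - B * real n) + r * (A - B * real (Suc n)) \<le> (sample_step \<gamma> ^^ n) h 1 1"
      unfolding h_pow using assms(1,2)
      by (intro add_mono mult_left_mono Suc.prems(2)) simp_all
    then show ?thesis by (simp add: algebra_simps)
  qed
  then have "(A - B * r) - B * (real m * r) \<le> (\<Sum>z\<in>?Z. h (?U z) (?V z))"
    by (intro Suc.IH h_hom)
  also have "\<dots> = (\<Sum>z\<in>?Z. \<Sum>w\<in>W. f (?U z * u w) (?V z * v w))"
    by (intro sum.cong refl) (simp only: h_def mix[of f, OF Suc.prems(1)])
  also have "\<dots> = (\<Sum>(z, w)\<in>?Z \<times> W. f (?U (w # z)) (?V (w # z)))"
    by (subst sum.cartesian_product) (simp add: mult.commute)
  also have "\<dots> = (\<Sum>z | set z \<subseteq> W \<and> length z = Suc m. f (?U z) (?V z))"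
    unfolding lists_length_Suc_eq
    by (subst sum.reindex) (auto simp: inj_on_def case_prod_unfold)
  finally show ?case by (simp add: algebra_simps)
qed

section \<open>Noisy labellings of a shattered set\<close>

lemma pmf_replicate_pmf:
  "pmf (replicate_pmf m D) z = (if length z = m then prod_list (map (pmf D) z) else 0)"
proof (induction m arbitrary: z)
  case (Suc m)
  let ?f = "\<lambda>(x, xs). x # xs"
  have eq: "replicate_pmf (Suc m) D = map_pmf ?f (pair_pmf D (replicate_pmf m D))"
    by (simp add: pair_pmf_def map_bind_pmf)
  have inj: "inj ?f" by (auto simp: inj_def)
  show ?case
  proof (cases z)
    case Nil
    have "z \<notin> set_pmf (replicate_pmf (Suc m) D)" by (auto simp: set_replicate_pmf Nil)
    then show ?thesis using Nil by (simp add: set_pmf_iff del: replicate_pmf.simps)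
  next
    case (Cons x xs)
    then show ?thesis
      using pmf_map_inj'[OF inj, of "pair_pmf D (replicate_pmf m D)" "(x, xs)"] Suc
      by (simp add: eq pmf_pair del: replicate_pmf.simps)
  qed
qed (auto simp: indicator_def)

lemma finite_labels: "finite labels"
  by (simp add: labels_def)

lemma uminus_labels: "y \<in> labels \<Longrightarrow> - y \<in> labels"
  by (auto simp: labels_def)

lemma sum_labels: "(\<Sum>y\<in>labels. f y) = f (- s) + f s" if "s \<in> labels"
  for f :: "int \<Rightarrow> real"
  using that by (auto simp: labels_def)

text \<open>On labels \<open>\<sigma> x * y\<close> is 1 or -1 according to whether \<open>y\<close>
  is the right label, so one formula covers both cases.\<close>

definition noise_weight :: "'x set \<Rightarrow> real \<Rightarrow> ('x \<Rightarrow> int) \<Rightarrow> 'x \<times> int \<Rightarrow> real" where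
  "noise_weight S \<gamma> \<sigma> = (\<lambda>(x, y). (1 + \<gamma> * real_of_int (\<sigma> x * y)) / (2 * real (card S)))"

definition noisy_dist :: "'x set \<Rightarrow> real \<Rightarrow> ('x \<Rightarrow> int) \<Rightarrow> ('x \<times> int) pmf" where
  "noisy_dist S \<gamma> \<sigma> = embed_pmf (\<lambda>w. if w \<in> S \<times> labels then noise_weight S \<gamma> \<sigma> w else 0)"

lemma noise_weight_nonneg:
  assumes "0 \<le> \<gamma>" "\<gamma> \<le> 1" "\<sigma> \<in> S \<rightarrow>\<^sub>E labels" "w \<in> S \<times> labels"
  shows "0 \<le> noise_weight S \<gamma> \<sigma> w"
proof -
  obtain x y where w: "w = (x, y)" "x \<in> S" "y \<in> labels" using assms(4) by auto
  then have "\<sigma> x \<in> labels" using assms(3) by auto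
  then have "real_of_int (\<sigma> x * y) = 1 \<or> real_of_int (\<sigma> x * y) = -1"
    using w by (auto simp: labels_def)
  then show ?thesis
    using assms(1,2) by (auto simp: noise_weight_def w simp del: of_int_mult)
qed

lemma sum_noise_weight_labels:
  assumes "\<sigma> \<in> S \<rightarrow>\<^sub>E labels" "x \<in> S"
  shows "(\<Sum>y\<in>labels. noise_weight S \<gamma> \<sigma> (x, y)) = 1 / real (card S)"
proof -
  have s: "\<sigma> x \<in> labels" using assms by auto
  then have "real_of_int (\<sigma> x) * real_of_int (\<sigma> x) = 1" by (auto simp: labels_def)
  then show ?thesis
    unfolding sum_labels[OF s] noise_weight_def
    by (simp add: add_divide_distrib[symmetric])
qed

lemma pmf_noisy_dist:
  assumes "finite S" "S \<noteq> {}" "0 \<le> \<gamma>" "\<gamma> \<le> 1" "\<sigma> \<in> S \<rightarrow>\<^sub>E labels"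
  shows "pmf (noisy_dist S \<gamma> \<sigma>) w = (if w \<in> S \<times> labels then noise_weight S \<gamma> \<sigma> w else 0)"
  unfolding noisy_dist_def
proof (rule pmf_embed_pmf)
  let ?f = "\<lambda>w. if w \<in> S \<times> labels then noise_weight S \<gamma> \<sigma> w else 0"
  show "0 \<le> ?f w" for w
    using noise_weight_nonneg[OF assms(3-5)] by simp
  have "(\<Sum>w\<in>S \<times> labels. noise_weight S \<gamma> \<sigma> w) = (\<Sum>x\<in>S. \<Sum>y\<in>labels. noise_weight S \<gamma> \<sigma> (x, y))"
    by (simp add: sum.cartesian_product)
  also have "\<dots> = 1"
    using assms(1,2) by (simp add: sum_noise_weight_labels[OF assms(5)])
  finally have 1: "(\<Sum>w\<in>S \<times> labels. noise_weight S \<gamma> \<sigma> w) = 1" .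
  have "(\<integral>\<^sup>+w. ennreal (?f w) \<partial>count_space UNIV) = (\<Sum>w\<in>S \<times> labels. ennreal (?f w))"
    using assms(1) by (intro nn_integral_count_space') (auto simp: finite_labels)
  also have "\<dots> = ennreal (\<Sum>w\<in>S \<times> labels. ?f w)"
    using noise_weight_nonneg[OF assms(3-5)] by (intro sum_ennreal) simp
  also have "(\<Sum>w\<in>S \<times> labels. ?f w) = (\<Sum>w\<in>S \<times> labels. noise_weight S \<gamma> \<sigma> w)"
    by (intro sum.cong) auto
  finally show "(\<integral>\<^sup>+w. ennreal (?f w) \<partial>count_space UNIV) = 1" using 1 by simp
qed

lemma set_noisy_dist:
  assumes "finite S" "S \<noteq> {}" "0 \<le> \<gamma>" "\<gamma> \<le> 1" "\<sigma> \<in> S \<rightarrow>\<^sub>E labels"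
  shows "set_pmf (noisy_dist S \<gamma> \<sigma>) \<subseteq> S \<times> labels"
  by (auto simp: set_pmf_iff pmf_noisy_dist[OF assms] split: if_splits)

section \<open>Excess risk as a multiple of the disagreement\<close>

definition disagreement :: "'x set \<Rightarrow> ('x \<Rightarrow> int) \<Rightarrow> ('x \<Rightarrow> int) \<Rightarrow> real" where
  "disagreement S h \<sigma> = real (card {x \<in> S. h x \<noteq> \<sigma> x}) / real (card S)"

lemma disagreement_bounds:
  assumes "finite S"
  shows "0 \<le> disagreement S h \<sigma>" "disagreement S h \<sigma> \<le> 1"
  using card_mono[of S "{x \<in> S. h x \<noteq> \<sigma> x}"] assms
  by (auto simp: disagreement_def divide_le_eq_1)

lemma disagreement_eq_sum:
  assumes "finite S"
  shows "disagreement S h \<sigma> = (\<Sum>x\<in>S. of_bool (h x \<noteq> \<sigma> x)) / real (card S)"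
proof -
  have "{x \<in> S. h x \<noteq> \<sigma> x} = S \<inter> {x. h x \<noteq> \<sigma> x}" by auto
  then show ?thesis using assms by (simp add: disagreement_def sum_of_bool_eq)
qed

text \<open>Up to a null set \<open>h\<close> errs exactly at the points \<open>(x, - h x)\<close>
  with \<open>x\<close> in \<open>S\<close>, and each of these weighs more by
  \<open>\<gamma> / card S\<close> where \<open>h\<close> disagrees with
  \<open>\<sigma>\<close>.\<close>

lemma err_noisy_dist:
  assumes "finite S" "S \<noteq> {}" "0 \<le> \<gamma>" "\<gamma> \<le> 1" "\<sigma> \<in> S \<rightarrow>\<^sub>E labels"
    and h: "\<And>x. x \<in> S \<Longrightarrow> h x \<in> labels"
  shows "err h (noisy_dist S \<gamma> \<sigma>) = (1 - \<gamma>) / 2 + \<gamma> * disagreement S h \<sigma>"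
proof -
  let ?D = "noisy_dist S \<gamma> \<sigma>" and ?B = "(\<lambda>x. (x, - h x)) ` S"
  have "err h ?D = measure_pmf.prob ?D ?B"
    unfolding err_def
  proof (intro measure_prob_cong_0)
    fix w assume "w \<in> {(x, y). h x \<noteq> y} - ?B"
    then show "pmf ?D w = 0"
      using h by (force simp: pmf_noisy_dist[OF assms(1-5)] labels_def)
  next
    fix w assume "w \<in> ?B - {(x, y). h x \<noteq> y}"
    then show "pmf ?D w = 0" by (auto dest: h simp: labels_def)
  qed
  also have "\<dots> = (\<Sum>x\<in>S. pmf ?D (x, - h x))"
    using assms(1) by (subst measure_measure_pmf_finite) (auto simp: sum.reindex inj_on_def)
  also have "\<dots> = (\<Sum>x\<in>S. (1 - \<gamma>) / (2 * real (card S)) + \<gamma> / real (card S) * of_bool (h x \<noteq> \<sigma> x))"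
  proof (intro sum.cong refl)
    fix x assume x: "x \<in> S"
    have "\<sigma> x \<in> labels" "h x \<in> labels" using x h assms(5) by auto
    then show "pmf ?D (x, - h x) =
        (1 - \<gamma>) / (2 * real (card S)) + \<gamma> / real (card S) * of_bool (h x \<noteq> \<sigma> x)"
      using x by (auto simp: pmf_noisy_dist[OF assms(1-5)] labels_def noise_weight_def
          diff_divide_distrib add_divide_distrib)
  qed
  also have "\<dots> = (1 - \<gamma>) / 2 + \<gamma> * disagreement S h \<sigma>"
    using assms(1,2) unfolding disagreement_eq_sum[OF assms(1)] sum.distrib sum_distrib_left[symmetric]
    by simp
  finally show ?thesis .
qed

text \<open>Shattering provides a hypothesis that equals \<open>\<sigma>\<close> on
  \<open>S\<close>, so the minimal error is \<open>(1 - \<gamma>) / 2\<close>.\<close>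

lemma excess_risk_noisy_dist:
  assumes "finite S" "S \<noteq> {}" "0 \<le> \<gamma>" "\<gamma> \<le> 1" "\<sigma> \<in> S \<rightarrow>\<^sub>E labels"
    and "finite H" "shatters H S" "h \<in> H"
  shows "excess_risk H h (noisy_dist S \<gamma> \<sigma>) = \<gamma> * disagreement S h \<sigma>"
proof -
  have lab: "g x \<in> labels" if "g \<in> H" "x \<in> S" for g x
  proof -
    have "restrict g S \<in> S \<rightarrow>\<^sub>E labels" using assms(7) that(1) unfolding shatters_def by blast
    then show ?thesis using that(2) by (metis PiE_mem restrict_apply')
  qed
  have err: "err g (noisy_dist S \<gamma> \<sigma>) = (1 - \<gamma>) / 2 + \<gamma> * disagreement S g \<sigma>" if "g \<in> H" for g
    by (rule err_noisy_dist[OF assms(1-5) lab[OF that]])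
  have "\<sigma> \<in> (\<lambda>h. restrict h S) ` H" using assms(5,7) by (simp add: shatters_def)
  then obtain g where g: "g \<in> H" "\<sigma> = restrict g S" by auto
  have "Min ((\<lambda>g. err g (noisy_dist S \<gamma> \<sigma>)) ` H) = (1 - \<gamma>) / 2"
  proof (rule Min_eqI)
    show "(1 - \<gamma>) / 2 \<le> e" if "e \<in> (\<lambda>g. err g (noisy_dist S \<gamma> \<sigma>)) ` H" for e
    proof -
      obtain g where "g \<in> H" "e = (1 - \<gamma>) / 2 + \<gamma> * disagreement S g \<sigma>"
        using \<open>e \<in> _\<close> err by auto
      then show ?thesis
        using mult_nonneg_nonneg[OF assms(3) disagreement_bounds(1)[OF assms(1), of g \<sigma>]] by linarith
    qed
    have "disagreement S g \<sigma> = 0" by (simp add: disagreement_def g(2))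
    then show "(1 - \<gamma>) / 2 \<in> (\<lambda>g. err g (noisy_dist S \<gamma> \<sigma>)) ` H"
      using g(1) err[OF g(1)] by (auto simp: image_iff intro!: bexI[of _ g])
  qed (use assms(6) in simp)
  then show ?thesis by (simp add: excess_risk_def err assms(8))
qed

section \<open>Averaging over sign patterns\<close>

text \<open>A letter at a point other than \<open>i\<close> has the same weight under both patterns,
  and homogeneity pulls it out. A letter at \<open>i\<close> acts as one \<open>sample_step\<close>.
  This is the mixing premise of \<open>sum_lists_ge_affine\<close> with
  \<open>r = 1 / card S\<close>.\<close>

lemma sum_noise_weight_flip:
  fixes f :: "real \<Rightarrow> real \<Rightarrow> real"
  assumes "finite S" "\<sigma> \<in> S \<rightarrow>\<^sub>E labels" "i \<in> S"
    and hom: "\<And>c a b. 0 \<le> c \<Longrightarrow> f (c * a) (c * b) = c * f a b"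
    and \<gamma>: "0 \<le> \<gamma>" "\<gamma> \<le> 1"
  shows "(\<Sum>w\<in>S \<times> labels. f (a * noise_weight S \<gamma> \<sigma> w) (b * noise_weight S \<gamma> (\<sigma>(i := - \<sigma> i)) w)) =
    (1 - 1 / real (card S)) * f a b + 1 / real (card S) * sample_step \<gamma> f a b"
proof -
  let ?u = "noise_weight S \<gamma> \<sigma>" and ?v = "noise_weight S \<gamma> (\<sigma>(i := - \<sigma> i))"
  let ?g = "\<lambda>x. \<Sum>y\<in>labels. f (a * ?u (x, y)) (b * ?v (x, y))"
  have hom': "f (a * c) (b * c) = c * f a b" if "0 \<le> c" for a b c
    using hom[OF that, of a b] by (simp add: mult.commute)
  have g1: "?g x = 1 / real (card S) * f a b" if x: "x \<in> S - {i}" for x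
  proof -
    have "?g x = (\<Sum>y\<in>labels. ?u (x, y) * f a b)"
    proof (intro sum.cong refl)
      fix y assume y: "y \<in> labels"
      have "?v (x, y) = ?u (x, y)" using x by (simp add: noise_weight_def)
      moreover have "0 \<le> ?u (x, y)" using x y by (intro noise_weight_nonneg \<gamma> assms(2)) simp
      ultimately show "f (a * ?u (x, y)) (b * ?v (x, y)) = ?u (x, y) * f a b"
        by (simp only: hom')
    qed
    then show ?thesis
      using sum_noise_weight_labels[OF assms(2), of x] x
      by (simp add: sum_distrib_right[symmetric])
  qed
  have s: "\<sigma> i \<in> labels" using assms(2,3) by auto
  then have ss: "\<sigma> i * \<sigma> i = 1" by (auto simp: labels_def)
  have w: "?u (i, - \<sigma> i) = (1 - \<gamma>) / 2 * (1 / real (card S))" "?u (i, \<sigma> i) = (1 + \<gamma>) / 2 * (1 / real (card S))"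
    "?v (i, - \<sigma> i) = (1 + \<gamma>) / 2 * (1 / real (card S))" "?v (i, \<sigma> i) = (1 - \<gamma>) / 2 * (1 / real (card S))"
    using ss by (simp_all add: noise_weight_def of_int_mult[symmetric] del: of_int_mult)
  have hd: "f (x * (1 / real (card S))) (y * (1 / real (card S))) = 1 / real (card S) * f x y" for x y
    by (rule hom') simp
  have "?g i = 1 / real (card S) * sample_step \<gamma> f a b"
    unfolding sum_labels[OF s] w mult.assoc[symmetric]
    by (simp only: hd sample_step_def distrib_left add.commute)
  moreover have "(\<Sum>x\<in>S - {i}. ?g x) = (1 - 1 / real (card S)) * f a b"
  proof -
    have "(\<Sum>x\<in>S - {i}. ?g x) = (\<Sum>x\<in>S - {i}. 1 / real (card S) * f a b)"
      by (intro sum.cong refl g1)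
    also have "\<dots> = real (card (S - {i})) * (1 / real (card S) * f a b)" by simp
    also have "real (card (S - {i})) = real (card S) - 1"
      using card_Suc_Diff1[OF assms(1,3)] by linarith
    also have "(real (card S) - 1) * (1 / real (card S) * f a b) = (1 - 1 / real (card S)) * f a b"
    proof -
      have "real (card S) \<noteq> 0" using assms(1,3) by auto
      then show ?thesis by (simp add: field_simps)
    qed
    finally show ?thesis .
  qed
  ultimately have "(\<Sum>x\<in>S. ?g x) = (1 - 1 / real (card S)) * f a b + 1 / real (card S) * sample_step \<gamma> f a b"
    using sum.remove[OF assms(1,3), of ?g] by simp
  then show ?thesis by (simp add: sum.cartesian_product)
qed

lemma flip_bij:
  assumes "i \<in> S"
  shows "bij_betw (\<lambda>\<sigma>. \<sigma>(i := - \<sigma> i)) (S \<rightarrow>\<^sub>E labels) (S \<rightarrow>\<^sub>E labels)"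
  by (rule bij_betwI[where g = "\<lambda>\<sigma>. \<sigma>(i := - \<sigma> i)"])
    (use assms uminus_labels in \<open>auto simp: PiE_iff extensional_def\<close>)

text \<open>Assouad's method: for each point \<open>i\<close>, \<open>\<sigma>\<close> is paired
  with its flip at \<open>i\<close>. Whatever \<open>L z i\<close> is, it is wrong for at least one
  of the two, so together they contribute at least the smaller likelihood of
  \<open>z\<close>.\<close>

lemma average_disagreement_ge:
  fixes L :: "('x \<times> int) list \<Rightarrow> 'x \<Rightarrow> int" and m :: nat
  assumes "finite S" "S \<noteq> {}" "0 \<le> \<gamma>" "\<gamma> \<le> 1"
    and affine: "\<And>n. A - B * real n \<le> (sample_step \<gamma> ^^ n) min 1 1"
  defines "Z \<equiv> {z. set z \<subseteq> S \<times> labels \<and> length z = m}"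
  shows "(A - B * (real m / real (card S))) / 2 * real (card (S \<rightarrow>\<^sub>E labels)) \<le>
    (\<Sum>\<sigma>\<in>S \<rightarrow>\<^sub>E labels. \<Sum>z\<in>Z. prod_list (map (noise_weight S \<gamma> \<sigma>) z) * disagreement S (L z) \<sigma>)"
proof -
  let ?\<Sigma> = "S \<rightarrow>\<^sub>E labels" and ?d = "real (card S)"
  let ?w = "\<lambda>\<sigma> z. prod_list (map (noise_weight S \<gamma> \<sigma>) z)"
  let ?flip = "\<lambda>i \<sigma>. \<sigma>(i := - \<sigma> i)"
  let ?a = "A - B * (real m / ?d)"
  have d: "?d > 0" using assms(1,2) by (simp add: card_gt_0_iff)
  have coord: "?a / 2 * real (card ?\<Sigma>) \<le> (\<Sum>\<sigma>\<in>?\<Sigma>. \<Sum>z\<in>Z. ?w \<sigma> z * of_bool (L z i \<noteq> \<sigma> i))"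
    if i: "i \<in> S" for i
  proof -
    let ?f = "\<lambda>\<sigma>. \<Sum>z\<in>Z. ?w \<sigma> z * of_bool (L z i \<noteq> \<sigma> i)"
    have "?a \<le> ?f \<sigma> + ?f (?flip i \<sigma>)" if \<sigma>: "\<sigma> \<in> ?\<Sigma>" for \<sigma>
    proof -
      have \<sigma>': "?flip i \<sigma> \<in> ?\<Sigma>" using bij_betwE[OF flip_bij[OF i]] \<sigma> by blast
      have "?a = A - B * (real m * (1 / ?d))" by simp
      also have "\<dots> \<le> (\<Sum>z\<in>Z. min (?w \<sigma> z) (?w (?flip i \<sigma>) z))"
        unfolding Z_def
      proof (rule sum_lists_ge_affine)
        show "1 / ?d \<le> 1" "0 \<le> 1 / ?d" using d by simp_all
        show "(\<Sum>w\<in>S \<times> labels. f (a * noise_weight S \<gamma> \<sigma> w) (b * noise_weight S \<gamma> (?flip i \<sigma>) w)) =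
            (1 - 1 / ?d) * f a b + 1 / ?d * sample_step \<gamma> f a b"
          if "\<And>c a b. 0 \<le> c \<Longrightarrow> f (c * a) (c * b) = c * f a b" for f a b
          by (rule sum_noise_weight_flip[OF assms(1) \<sigma> i _ assms(3,4)]) (rule that)
        show "min (c * a) (c * b) = c * min a b" if "0 \<le> c" for a b c :: real
          using that by (simp add: min_mult_distrib_left)
      qed (rule affine)
      also have "\<dots> \<le> (\<Sum>z\<in>Z. ?w \<sigma> z * of_bool (L z i \<noteq> \<sigma> i)
          + ?w (?flip i \<sigma>) z * of_bool (L z i \<noteq> ?flip i \<sigma> i))"
      proof (rule sum_mono)
        fix z assume z: "z \<in> Z"
        have nonneg: "0 \<le> ?w \<tau> z" if \<tau>: "\<tau> \<in> ?\<Sigma>" for \<tau>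
        proof (rule prod_list_nonneg)
          fix t assume "t \<in> set (map (noise_weight S \<gamma> \<tau>) z)"
          then obtain w where w: "w \<in> set z" "t = noise_weight S \<gamma> \<tau> w"
            unfolding set_map by blast
          then have "w \<in> S \<times> labels" using z unfolding Z_def by blast
          then show "0 \<le> t" unfolding w(2) by (rule noise_weight_nonneg[OF assms(3,4) \<tau>])
        qed
        have "0 \<le> ?w \<sigma> z" "0 \<le> ?w (?flip i \<sigma>) z"
          using nonneg \<sigma> \<sigma>' by blast+
        moreover have "\<sigma> i \<noteq> - \<sigma> i" using \<sigma> i by (auto simp: labels_def PiE_iff)
        ultimately show "min (?w \<sigma> z) (?w (?flip i \<sigma>) z) \<le> ?w \<sigma> z * of_bool (L z i \<noteq> \<sigma> i)
            + ?w (?flip i \<sigma>) z * of_bool (L z i \<noteq> ?flip i \<sigma> i)"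
          by (cases "L z i = \<sigma> i") (simp_all add: min_def)
      qed
      finally show ?thesis by (simp only: sum.distrib)
    qed
    then have "?a * real (card ?\<Sigma>) \<le> (\<Sum>\<sigma>\<in>?\<Sigma>. ?f \<sigma> + ?f (?flip i \<sigma>))"
      using sum_bounded_below[of ?\<Sigma> ?a "\<lambda>\<sigma>. ?f \<sigma> + ?f (?flip i \<sigma>)"] by (simp only: mult.commute)
    \<comment> \<open>The flip permutes the patterns, so every pattern is counted twice.\<close>
    also have "\<dots> = 2 * (\<Sum>\<sigma>\<in>?\<Sigma>. ?f \<sigma>)"
      using sum.reindex_bij_betw[OF flip_bij[OF i], of ?f] by (simp only: sum.distrib)
    finally show ?thesis by simp
  qed
  have "?a / 2 * real (card ?\<Sigma>) * ?d = (\<Sum>i\<in>S. ?a / 2 * real (card ?\<Sigma>))" by simp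
  also have "\<dots> \<le> (\<Sum>i\<in>S. \<Sum>\<sigma>\<in>?\<Sigma>. \<Sum>z\<in>Z. ?w \<sigma> z * of_bool (L z i \<noteq> \<sigma> i))"
    by (intro sum_mono coord)
  also have "\<dots> = (\<Sum>\<sigma>\<in>?\<Sigma>. \<Sum>i\<in>S. \<Sum>z\<in>Z. ?w \<sigma> z * of_bool (L z i \<noteq> \<sigma> i))"
    by (rule sum.swap)
  also have "\<dots> = (\<Sum>\<sigma>\<in>?\<Sigma>. \<Sum>z\<in>Z. \<Sum>i\<in>S. ?w \<sigma> z * of_bool (L z i \<noteq> \<sigma> i))"
    by (intro sum.cong refl sum.swap)
  also have "\<dots> = (\<Sum>\<sigma>\<in>?\<Sigma>. \<Sum>z\<in>Z. ?w \<sigma> z * disagreement S (L z) \<sigma>) * ?d"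
    using d unfolding disagreement_eq_sum[OF assms(1)] sum_distrib_right
    by (intro sum.cong refl) (simp add: sum_distrib_left)
  finally show ?thesis using d by simp
qed

text \<open>If every pattern gave probability below \<open>q\<close>, then its mean disagreement, at
  most 1 on the event and at most \<open>u\<close> off it, would be below
  \<open>q * (1 - u) + u\<close>, against the average over patterns.\<close>

lemma exists_noisy_dist:
  fixes L :: "('x \<times> int) list \<Rightarrow> 'x \<Rightarrow> int"
  assumes "finite S" "S \<noteq> {}" "S \<subseteq> X" and \<gamma>: "0 < \<gamma>" "\<gamma> \<le> 1"
    and "finite H" "shatters H S" "L \<in> samples m X \<rightarrow> H"
    and affine: "\<And>n. A - B * real n \<le> (sample_step \<gamma> ^^ n) min 1 1"
    and u: "u < 1" "\<epsilon> \<le> \<gamma> * u"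
    and q: "q * (1 - u) + u \<le> (A - B * (real m / real (card S))) / 2"
  shows "\<exists>D \<in> distributions_on X.
    measure_pmf.prob (replicate_pmf m D) {z. excess_risk H (L z) D > \<epsilon>} \<ge> q"
proof (rule ccontr)
  assume contra: "\<not> ?thesis"
  define Z where "Z = {z. set z \<subseteq> S \<times> labels \<and> length z = m}"
  let ?\<Sigma> = "S \<rightarrow>\<^sub>E labels"
  let ?w = "\<lambda>\<sigma> z. prod_list (map (noise_weight S \<gamma> \<sigma>) z)"
  let ?P = "\<lambda>\<sigma>. replicate_pmf m (noisy_dist S \<gamma> \<sigma>)"
  note \<gamma>' = less_imp_le[OF \<gamma>(1)] \<gamma>(2)
  have finZ: "finite Z"
    unfolding Z_def using assms(1) by (intro finite_lists_length_eq) (simp add: finite_labels)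
  have fin\<Sigma>: "finite ?\<Sigma>" using assms(1) by (simp add: finite_PiE finite_labels)
  have "(\<lambda>x\<in>S. 1) \<in> ?\<Sigma>" by (auto simp: labels_def)
  then have ne: "?\<Sigma> \<noteq> {}" by blast
  have less: "(\<Sum>z\<in>Z. ?w \<sigma> z * disagreement S (L z) \<sigma>) < q * (1 - u) + u" if \<sigma>: "\<sigma> \<in> ?\<Sigma>" for \<sigma>
  proof -
    let ?E = "{z. excess_risk H (L z) (noisy_dist S \<gamma> \<sigma>) > \<epsilon>}"
    have pmf: "pmf (?P \<sigma>) z = ?w \<sigma> z" if "z \<in> Z" for z
    proof -
      have "map (pmf (noisy_dist S \<gamma> \<sigma>)) z = map (noise_weight S \<gamma> \<sigma>) z"
        using that by (intro map_cong refl) (auto simp: Z_def pmf_noisy_dist[OF assms(1,2) \<gamma>' \<sigma>])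
      moreover have "length z = m" using that by (simp add: Z_def)
      ultimately show ?thesis by (simp add: pmf_replicate_pmf del: map_eq_conv)
    qed
    have "set_pmf (?P \<sigma>) \<subseteq> Z"
      using set_noisy_dist[OF assms(1,2) \<gamma>' \<sigma>] by (auto simp: set_replicate_pmf Z_def)
    then have sum1: "(\<Sum>z\<in>Z. pmf (?P \<sigma>) z) = 1"
      by (rule sum_pmf_eq_1[OF finZ])
    have "noisy_dist S \<gamma> \<sigma> \<in> distributions_on X"
      using set_noisy_dist[OF assms(1,2) \<gamma>' \<sigma>] assms(3) by (auto simp: distributions_on_def)
    then have "measure_pmf.prob (?P \<sigma>) ?E < q" using contra by (auto simp: not_le)
    moreover have "(\<Sum>z\<in>Z. pmf (?P \<sigma>) z * of_bool (z \<in> ?E)) \<le> measure_pmf.prob (?P \<sigma>) ?E"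
    proof -
      have "(\<Sum>z\<in>Z. pmf (?P \<sigma>) z * of_bool (z \<in> ?E)) = (\<Sum>z\<in>Z \<inter> ?E. pmf (?P \<sigma>) z)"
        using finZ by (simp add: sum.inter_restrict[OF finZ] of_bool_def if_distrib cong: if_cong)
      also have "\<dots> = measure_pmf.prob (?P \<sigma>) (Z \<inter> ?E)"
        using finZ by (simp add: measure_measure_pmf_finite)
      also have "\<dots> \<le> measure_pmf.prob (?P \<sigma>) ?E"
        by (intro measure_pmf.finite_measure_mono) auto
      finally show ?thesis .
    qed
    moreover have "(\<Sum>z\<in>Z. ?w \<sigma> z * disagreement S (L z) \<sigma>) \<le>
        (\<Sum>z\<in>Z. pmf (?P \<sigma>) z * (of_bool (z \<in> ?E) * (1 - u) + u))"
    proof (rule sum_mono)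
      fix z assume z: "z \<in> Z"
      then have "L z \<in> H" using assms(3,8) by (force simp: Z_def samples_def Pi_iff)
      then have ex: "excess_risk H (L z) (noisy_dist S \<gamma> \<sigma>) = \<gamma> * disagreement S (L z) \<sigma>"
        by (rule excess_risk_noisy_dist[OF assms(1,2) \<gamma>' \<sigma> assms(6,7)])
      have "disagreement S (L z) \<sigma> \<le> of_bool (z \<in> ?E) * (1 - u) + u"
      proof (cases "z \<in> ?E")
        case True
        then show ?thesis using disagreement_bounds(2)[OF assms(1), of "L z" \<sigma>] by simp
      next
        case False
        have "disagreement S (L z) \<sigma> \<le> u"
        proof (rule ccontr)
          assume "\<not> disagreement S (L z) \<sigma> \<le> u"
          then have "\<gamma> * u < \<gamma> * disagreement S (L z) \<sigma>" using \<gamma> by simp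
          then show False using False u ex by simp
        qed
        then show ?thesis using False by simp
      qed
      then show "?w \<sigma> z * disagreement S (L z) \<sigma> \<le> pmf (?P \<sigma>) z * (of_bool (z \<in> ?E) * (1 - u) + u)"
        unfolding pmf[OF z, symmetric] by (intro mult_left_mono) auto
    qed
    moreover have "(\<Sum>z\<in>Z. pmf (?P \<sigma>) z * (of_bool (z \<in> ?E) * (1 - u) + u)) =
        (\<Sum>z\<in>Z. pmf (?P \<sigma>) z * of_bool (z \<in> ?E)) * (1 - u) + u"
      by (simp only: distrib_left sum.distrib sum_distrib_right[symmetric] mult.assoc[symmetric]
          sum1 mult_1_left)
    ultimately show ?thesis
      using u(1) mult_strict_right_mono[of "(\<Sum>z\<in>Z. pmf (?P \<sigma>) z * of_bool (z \<in> ?E))" q "1 - u"]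
      by linarith
  qed
  have "(\<Sum>\<sigma>\<in>?\<Sigma>. \<Sum>z\<in>Z. ?w \<sigma> z * disagreement S (L z) \<sigma>) < (\<Sum>\<sigma>\<in>?\<Sigma>. q * (1 - u) + u)"
    by (rule sum_strict_mono[OF fin\<Sigma> ne less])
  also have "\<dots> \<le> (A - B * (real m / real (card S))) / 2 * real (card ?\<Sigma>)"
    using mult_left_mono[OF q of_nat_0_le_iff[of "card ?\<Sigma>"]] by (simp only: sum_constant mult.commute)
  also have "\<dots> \<le> (\<Sum>\<sigma>\<in>?\<Sigma>. \<Sum>z\<in>Z. ?w \<sigma> z * disagreement S (L z) \<sigma>)"
    unfolding Z_def by (rule average_disagreement_ge[OF assms(1,2) \<gamma>' affine])
  finally show False by simp
qed

text \<open>Removes \<nu> from the second-order terms \<open>y * g\<^sup>2\<close>, where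
  \<open>g = C / \<nu>\<close>.\<close>

lemma quarter_square_bound:
  fixes y \<nu> C :: real
  assumes "4 * y \<le> \<nu> * \<nu>" "0 < \<nu>"
  shows "y * (C / \<nu>)\<^sup>2 \<le> C\<^sup>2 / 4"
proof -
  have "4 * y / (\<nu> * \<nu>) * (C\<^sup>2 / 4) \<le> 1 * (C\<^sup>2 / 4)"
    using assms by (intro mult_right_mono) (auto simp: divide_le_eq)
  then show ?thesis by (simp add: power_divide power2_eq_square)
qed

section \<open>Estimates of the Bayes error\<close>

text \<open>
  With \<open>\<nu> = 2k - 1 + 2\<theta>\<close> \<open>\<gamma>/2 * return_prob k\<close> times the left-hand side bounds
  at \<open>\<nu>\<close>, to second order in \<open>g = \<gamma>\<^sup>2\<close>, the secant of \<open>1/2\<close> minus the Bayes error through \<open>2k - 1\<close> and \<open>2k + 1\<close>.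
\<close>

lemma bracket_bound:
  fixes \<nu> C \<theta> \<nu>0 :: real and k :: nat
  defines "g \<equiv> C / \<nu>" and "\<alpha> \<equiv> 1 - C / 6 + C\<^sup>2 / 40"
  defines "\<beta> \<equiv> \<alpha> + C / 6 + C / (6 * \<nu>0)" and "\<eta> \<equiv> 2 * \<alpha> - 1 + C / 6 - C\<^sup>2 / 8 + C / (6 * \<nu>0)"
  assumes k: "2 \<le> k" and \<theta>: "0 \<le> \<theta>" "\<theta> \<le> 1" and \<nu>: "\<nu> = 2 * real k - 1 + 2 * \<theta>"
    and C: "0 \<le> C" and \<nu>0: "0 < \<nu>0" "\<nu>0 \<le> \<nu>"
  shows "2 * real k * (1 - (real k - 1) / 3 * g + (real k - 1) * (real k - 2) / 10 * g\<^sup>2)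
      + \<theta> * (1 - real k * g + real k * (real k - 1) / 2 * g\<^sup>2)
    \<le> \<alpha> * \<nu> + \<beta> - \<eta> * \<theta>"
proof -
  define x where "x = real k"
  have x: "2 \<le> x" using k by (simp add: x_def)
  have \<nu>x: "\<nu> = 2 * x - 1 + 2 * \<theta>" using \<nu> by (simp add: x_def)
  have pos: "0 < \<nu>" using \<nu>0 by simp
  have "2 * x - 2 \<le> \<nu>" "2 * x - 4 \<le> \<nu>" using \<nu>x \<theta> by simp_all
  then have "(2 * x - 2) * (2 * x - 4) \<le> \<nu> * \<nu>"
    using x pos by (intro mult_mono) auto
  then have "(x - 1) * (x - 2) * g\<^sup>2 \<le> C\<^sup>2 / 4"
    unfolding g_def using pos by (intro quarter_square_bound) (simp_all add: algebra_simps)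
  then have A1: "2 * x * ((x - 1) * (x - 2) / 10 * g\<^sup>2) \<le> 2 * x * (C\<^sup>2 / 40)"
    using x by (intro mult_left_mono) (auto simp: field_simps)
  have A2: "\<theta> * (x * (x - 1) / 2 * g\<^sup>2) \<le> \<theta> * (C\<^sup>2 / 8)"
  proof -
    \<comment> \<open>From \<open>4 * k * (k - 1) = (2 * k - 1)\<^sup>2 - 1\<close> and
      \<open>2 * k - 1 \<le> \<nu>\<close>.\<close>
    have "0 \<le> (\<nu> - (2 * x - 1)) * (\<nu> + (2 * x - 1)) + 1"
      using x \<theta> \<nu>x by (intro add_nonneg_nonneg mult_nonneg_nonneg) auto
    then have "4 * (x * (x - 1)) \<le> \<nu> * \<nu>" by (simp add: algebra_simps)
    then have "x * (x - 1) * g\<^sup>2 \<le> C\<^sup>2 / 4"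
      unfolding g_def using pos by (rule quarter_square_bound)
    then show ?thesis using \<theta> by (intro mult_left_mono) auto
  qed
  \<comment> \<open>With constants for the second-order terms, eliminating \<open>k\<close> leaves
    an expression affine in \<nu> and \<theta> and a remainder of order
    \<open>1 / \<nu>\<close>.\<close>
  have A3: "2 * x * (1 - (x - 1) / 3 * g + C\<^sup>2 / 40) + \<theta> * (1 - x * g + C\<^sup>2 / 8) =
      \<alpha> * \<nu> + (\<alpha> + C / 6 + \<theta> * (1 - 2 * \<alpha> - C / 6 + C\<^sup>2 / 8))
      + C / (6 * \<nu>) * ((1 - \<theta>) * (1 - 2 * \<theta>))"
  proof -
    have "2 * x = \<nu> + 1 - 2 * \<theta>" using \<nu>x by simp
    then have x_eq: "x = (\<nu> + 1 - 2 * \<theta>) / 2" by simp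
    show ?thesis
      unfolding x_eq using pos by (simp add: g_def \<alpha>_def field_simps power2_eq_square)
  qed
  define D where "D = C / (6 * \<nu>0)"
  \<comment> \<open>Bounding \<open>1 - 2 * \<theta>\<close> by 1 makes the remainder affine in
    \<theta> too.\<close>
  have A4: "C / (6 * \<nu>) * ((1 - \<theta>) * (1 - 2 * \<theta>)) \<le> D * (1 - \<theta>)"
  proof -
    have "C / (6 * \<nu>) * ((1 - \<theta>) * (1 - 2 * \<theta>)) \<le> C / (6 * \<nu>) * ((1 - \<theta>) * 1)"
      using C pos \<theta> by (intro mult_left_mono) auto
    also have "\<dots> \<le> C / (6 * \<nu>0) * ((1 - \<theta>) * 1)"
      using C pos \<theta> \<nu>0 by (intro mult_right_mono divide_left_mono) auto
    finally show ?thesis by (simp add: D_def)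
  qed
  have lhs: "2 * x * (s + E) + \<theta> * (t + F) =
      (2 * x * (s + c) + \<theta> * (t + c')) + (2 * x * E - 2 * x * c) + (\<theta> * F - \<theta> * c')"
    for s t E F c c' :: real
    by (simp add: algebra_simps)
  have rhs: "\<alpha> * \<nu> + \<beta> - \<eta> * \<theta> =
      \<alpha> * \<nu> + (\<alpha> + C / 6 + \<theta> * (1 - 2 * \<alpha> - C / 6 + C\<^sup>2 / 8)) + D * (1 - \<theta>)"
    unfolding \<beta>_def \<eta>_def D_def[symmetric] by (simp add: algebra_simps)
  have step: "M + (E - E') + (F - F') \<le> R + N'" if "E \<le> E'" "F \<le> F'" "M = R + N" "N \<le> N'"
    for M E E' F F' R N N' :: real
    using that by linarith
  show ?thesis
    unfolding x_def[symmetric] rhs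
    by (rule ord_eq_le_trans[OF lhs step[OF A1 A2 A3 A4]])
qed

text \<open>Both summands are controlled by \<open>return_prob k\<close>. Squaring removes the root
  and lets \<open>return_prob_square_bound\<close> apply, where
  \<open>2 * (k + 3 / 11) = \<nu> + 17 / 11 - 2 * \<theta>\<close>; what remains is the polynomial
  premise on \<open>Q\<close>.\<close>

lemma bias_bound:
  fixes \<nu> C T \<theta> F \<alpha> :: real and k :: nat
  assumes k: "2 \<le> k" and \<theta>: "0 \<le> \<theta>" and \<nu>: "\<nu> = 2 * real k - 1 + 2 * \<theta>"
    and C: "0 \<le> C" "C \<le> \<nu>" and T: "0 \<le> T"
    and P: "2 * real k * (1 - (real k - 1) / 3 * (C / \<nu>) + (real k - 1) * (real k - 2) / 10 * (C / \<nu>)\<^sup>2)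
      + \<theta> * (1 - real k * (C / \<nu>) + real k * (real k - 1) / 2 * (C / \<nu>)\<^sup>2) \<le> Q"
    and Q: "225 / 704 * C * Q\<^sup>2 \<le> 2 * T\<^sup>2 * \<nu> * (\<nu> + 17 / 11 - 2 * \<theta>)"
  shows "sqrt (C / \<nu>) * ((\<Sum>j<k. return_prob j * (1 - C / \<nu>) ^ j) + return_prob k * (1 - C / \<nu>) ^ k * \<theta>) \<le> 2 * T"
proof -
  have pos: "0 < \<nu>" using k \<theta> \<nu> by simp
  define g where "g = C / \<nu>"
  have g: "0 \<le> g" "g \<le> 1" using pos C by (simp_all add: g_def)
  let ?S = "(\<Sum>j<k. return_prob j * (1 - g) ^ j) + return_prob k * (1 - g) ^ k * \<theta>"
  have "return_prob k * (1 - g) ^ k * \<theta> \<le> return_prob k * (1 - real k * g + real k * (real k - 1) / 2 * g\<^sup>2) * \<theta>"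
    using power_one_minus_le_quadratic[OF g, of k] return_prob_pos[of k] \<theta>
    by (intro mult_right_mono mult_left_mono) auto
  then have "?S \<le> return_prob k * (2 * real k * (1 - (real k - 1) / 3 * g + (real k - 1) * (real k - 2) / 10 * g\<^sup>2)
      + \<theta> * (1 - real k * g + real k * (real k - 1) / 2 * g\<^sup>2))"
    using sum_return_prob_power_le[OF g, of k] by (simp add: algebra_simps)
  also have "\<dots> \<le> return_prob k * Q"
    using P return_prob_pos[of k] by (simp add: g_def)
  finally have S: "?S \<le> return_prob k * Q" .
  have S0: "0 \<le> ?S"
    using g return_prob_pos \<theta> by (intro add_nonneg_nonneg sum_nonneg mult_nonneg_nonneg) (auto intro: less_imp_le)
  have "(sqrt g * ?S)\<^sup>2 \<le> (2 * T)\<^sup>2"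
  proof -
    have k': "0 < real k + 3 / 11" by (simp add: add_pos_pos)
    have "(sqrt g * ?S)\<^sup>2 = g * ?S\<^sup>2" using g by (simp add: power_mult_distrib)
    also have "\<dots> \<le> g * (return_prob k * Q)\<^sup>2"
      using S S0 g by (intro mult_left_mono power_mono) auto
    also have "\<dots> = (return_prob k)\<^sup>2 * (C * Q\<^sup>2) / \<nu>" by (simp add: g_def power_mult_distrib)
    also have "\<dots> \<le> 225 / 704 / (real k + 3 / 11) * (C * Q\<^sup>2) / \<nu>"
      using return_prob_square_bound[OF k] pos_le_divide_eq[OF k', of "(return_prob k)\<^sup>2" "225 / 704"] C pos
      by (intro divide_right_mono mult_right_mono) simp_all
    also have "\<dots> = 225 / 704 * C * Q\<^sup>2 / ((real k + 3 / 11) * \<nu>)"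
      by (simp only: times_divide_eq_left times_divide_eq_right divide_divide_eq_left mult.assoc)
    also have "\<dots> \<le> 2 * T\<^sup>2 * \<nu> * (\<nu> + 17 / 11 - 2 * \<theta>) / ((real k + 3 / 11) * \<nu>)"
      using Q k' pos by (intro divide_right_mono) auto
    also have "\<nu> + 17 / 11 - 2 * \<theta> = 2 * (real k + 3 / 11)" using \<nu> by simp
    also have "2 * T\<^sup>2 * \<nu> * (2 * K) / (K * \<nu>) = (2 * T)\<^sup>2" if "0 < K" for K
      using that pos by (simp add: power_mult_distrib)
    note this[OF k']
    finally show ?thesis .
  qed
  then show ?thesis
    unfolding g_def by (rule power2_le_imp_le) (use T in simp)
qed

section \<open>Reduction to numerical inequalities\<close>

lemma quadratic_nonneg_on_strip:
  fixes p r s w b e n \<mu> x \<theta> :: real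
  assumes "0 \<le> p" "0 \<le> \<mu>" "0 \<le> \<theta>" "\<theta> \<le> 1" "n + \<mu> * \<theta> \<le> x"
    and "0 \<le> 2 * p * n + r" "0 \<le> 2 * p * (n + \<mu>) + r - s"
    and concave: "p * \<mu>\<^sup>2 - s * \<mu> - w * e\<^sup>2 \<le> 0"
    and "0 \<le> p * n\<^sup>2 + r * n - w * b\<^sup>2"
    and "0 \<le> p * (n + \<mu>)\<^sup>2 + (r - s) * (n + \<mu>) - w * (b - e)\<^sup>2"
  shows "0 \<le> p * x\<^sup>2 + (r - s * \<theta>) * x - w * (b - e * \<theta>)\<^sup>2"
proof -
  define y where "y = x - (n + \<mu> * \<theta>)"
  have y: "0 \<le> y" using assms(5) by (simp add: y_def)
  have "0 \<le> (1 - \<theta>) * (2 * p * n + r)" and "0 \<le> \<theta> * (2 * p * (n + \<mu>) + r - s)"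
    by (intro mult_nonneg_nonneg; use assms in simp)+
  note lin = mult_nonneg_nonneg[OF y add_nonneg_nonneg[OF this]]
  \<comment> \<open>On the line \<open>x = n + \<mu> * \<theta>\<close> a quadratic in \<theta> is
    its chord minus \<open>\<theta> * (1 - \<theta>)\<close> times its leading coefficient. The
    terms in \<open>y\<close> are the Taylor expansion in \<open>x\<close> off that line.\<close>
  have "0 \<le> (1 - \<theta>) * (p * n\<^sup>2 + r * n - w * b\<^sup>2)
      + \<theta> * (p * (n + \<mu>)\<^sup>2 + (r - s) * (n + \<mu>) - w * (b - e)\<^sup>2)
      + \<theta> * (1 - \<theta>) * - (p * \<mu>\<^sup>2 - s * \<mu> - w * e\<^sup>2)
      + y * ((1 - \<theta>) * (2 * p * n + r) + \<theta> * (2 * p * (n + \<mu>) + r - s)) + p * y\<^sup>2"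
    by (intro add_nonneg_nonneg lin; intro mult_nonneg_nonneg; use assms in simp)
  also have "\<dots> = p * x\<^sup>2 + (r - s * \<theta>) * x - w * (b - e * \<theta>)\<^sup>2"
    unfolding y_def by (simp add: algebra_simps power2_eq_square)
  finally show ?thesis .
qed

text \<open>
  The premises are ground numerical facts once \<open>C\<close>, \<open>T\<close>, \<open>n\<close> and \<open>\<mu>\<close> are fixed: convexity in \<open>\<nu>\<close>
  and concavity in \<open>\<theta>\<close> reduce the inequality to \<open>\<theta> = 0\<close> and \<open>\<theta> = 1\<close> on the line \<open>\<nu> = n + \<mu> \<theta>\<close>.
\<close>

lemma rate_inequality:
  fixes C T a b e \<nu> n \<mu> \<theta> :: real
  defines "\<kappa> \<equiv> 225 / 704"
  defines "p \<equiv> 2 * T\<^sup>2 - \<kappa> * C * a\<^sup>2" and "r \<equiv> 34 / 11 * T\<^sup>2 - 2 * \<kappa> * C * a * b"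
    and "s \<equiv> 4 * T\<^sup>2 - 2 * \<kappa> * C * a * e"
  assumes "0 \<le> \<theta>" "\<theta> \<le> 1" "0 \<le> \<mu>" "n + \<mu> * \<theta> \<le> \<nu>"
    and "0 \<le> p" "0 \<le> 2 * p * n + r" "0 \<le> 2 * p * (n + \<mu>) + r - s"
    and "p * \<mu>\<^sup>2 - s * \<mu> - \<kappa> * C * e\<^sup>2 \<le> 0"
    and "0 \<le> p * n\<^sup>2 + r * n - \<kappa> * C * b\<^sup>2"
    and "0 \<le> p * (n + \<mu>)\<^sup>2 + (r - s) * (n + \<mu>) - \<kappa> * C * (b - e)\<^sup>2"
  shows "225 / 704 * C * (a * \<nu> + b - e * \<theta>)\<^sup>2 \<le> 2 * T\<^sup>2 * \<nu> * (\<nu> + 17 / 11 - 2 * \<theta>)"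
proof -
  have "0 \<le> p * \<nu>\<^sup>2 + (r - s * \<theta>) * \<nu> - \<kappa> * C * (b - e * \<theta>)\<^sup>2"
    using assms(5-) by (intro quadratic_nonneg_on_strip[of p \<mu> \<theta> n])
  also have "\<dots> = 2 * T\<^sup>2 * \<nu> * (\<nu> + 17 / 11 - 2 * \<theta>) - \<kappa> * C * (a * \<nu> + b - e * \<theta>)\<^sup>2"
    unfolding p_def r_def s_def by (simp add: algebra_simps power2_eq_square)
  finally show ?thesis by (simp add: \<kappa>_def)
qed

text \<open>\<open>T\<close> is how far the mean Bayes error may drop below \<open>1/2\<close>:
  \<open>p = 1 / 2 - T\<close> solves \<open>q = (p - u) / (1 - u)\<close>. The premise on
  \<open>C * u\<^sup>2 * K\<close> makes \<open>\<gamma> * u\<close> at least the claimed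
  excess.\<close>

lemma excess_risk_lower_bound:
  fixes C T u q K \<nu> n :: real
  defines "T \<equiv> 1 / 2 - q - (1 - q) * u"
  defines "\<alpha> \<equiv> 1 - C / 6 + C\<^sup>2 / 40"
  defines "\<beta> \<equiv> \<alpha> + C / 6 + C / (6 * n)" and "\<eta> \<equiv> 2 * \<alpha> - 1 + C / 6 - C\<^sup>2 / 8 + C / (6 * n)"
  assumes S: "finite S" "S \<noteq> {}" "S \<subseteq> X" and H: "finite H" "shatters H S"
    and L: "L \<in> samples m X \<rightarrow> H"
    and \<nu>: "\<nu> = real m / real (card S)" "3 \<le> \<nu>" "0 < n" "n \<le> \<nu>"
    and C: "0 < C" "C \<le> 3" and T: "0 \<le> T" and u: "0 < u" "u < 1" "1 \<le> C * u\<^sup>2 * K" and K: "0 < K"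
    and rate: "\<And>\<theta>. 0 \<le> \<theta> \<Longrightarrow> \<theta> \<le> 1 \<Longrightarrow> 3 + 2 * \<theta> \<le> \<nu> \<Longrightarrow>
      225 / 704 * C * (\<alpha> * \<nu> + \<beta> - \<eta> * \<theta>)\<^sup>2 \<le> 2 * T\<^sup>2 * \<nu> * (\<nu> + 17 / 11 - 2 * \<theta>)"
  shows "\<exists>D \<in> distributions_on X.
    measure_pmf.prob (replicate_pmf m D) {z. excess_risk H (L z) D > 1 / sqrt (K * \<nu>)} \<ge> q"
proof -
  \<comment> \<open>This selects the secant with \<open>2 * k - 1 \<le> \<nu> < 2 * k + 1\<close>;
    \<theta> is the relative position of \<nu> in that interval.\<close>
  define k where "k = nat \<lfloor>(\<nu> + 1) / 2\<rfloor>"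
  define \<theta> where "\<theta> = (\<nu> + 1) / 2 - real k"
  have k2: "2 \<le> k" using \<nu>(2) by (simp add: k_def le_nat_iff le_floor_iff)
  have k: "real k = of_int \<lfloor>(\<nu> + 1) / 2\<rfloor>" using \<nu>(2) by (simp add: k_def)
  have \<theta>: "0 \<le> \<theta>" "\<theta> \<le> 1" unfolding \<theta>_def k by linarith+
  have \<nu>k: "\<nu> = 2 * real k - 1 + 2 * \<theta>" by (simp add: \<theta>_def field_simps)
  have "3 + 2 * \<theta> \<le> \<nu>" using k2 \<nu>k by simp
  define \<gamma> where "\<gamma> = sqrt (C / \<nu>)"
  have "0 < C / \<nu>" "C / \<nu> \<le> 1" using C \<nu>(2) by simp_all
  then have \<gamma>: "0 < \<gamma>" "\<gamma> \<le> 1" and \<gamma>2: "\<gamma>\<^sup>2 = C / \<nu>"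
    unfolding \<gamma>_def by simp_all
  let ?S = "\<Sum>j<k. return_prob j * (1 - \<gamma>\<^sup>2) ^ j" and ?e = "return_prob k * (1 - \<gamma>\<^sup>2) ^ k"
  note bracket = bracket_bound[OF k2 \<theta> \<nu>k less_imp_le[OF C(1)] \<nu>(3,4), folded \<alpha>_def, folded \<beta>_def \<eta>_def]
  have bias: "\<gamma> * (?S + ?e * \<theta>) \<le> 2 * T"
    unfolding \<gamma>2 unfolding \<gamma>_def
    by (rule bias_bound[OF k2 \<theta>(1) \<nu>k _ _ T bracket rate])
      (use C \<nu>(2) \<theta> \<open>3 + 2 * \<theta> \<le> \<nu>\<close> in auto)
  \<comment> \<open>Intercept and negated slope of the secant as a function of the number of
    labels.\<close>
  define A B where "A = 1 - \<gamma> * (?S + ?e * (1 - 2 * real k) / 2)" and "B = \<gamma> * ?e / 2"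
  show ?thesis
  proof (rule exists_noisy_dist[OF S \<gamma> H L])
    show "A - B * real n \<le> (sample_step \<gamma> ^^ n) min 1 1" for n
    proof -
      have "A - B * real n = 1 - \<gamma> * (?S + ?e * (real n + 1 - 2 * real k) / 2)"
        by (simp add: A_def B_def field_simps)
      then show ?thesis
        using sample_step_funpow_min_ge[of \<gamma> k n] \<gamma> by simp
    qed
    show "u < 1" by (rule u(2))
    have "1 / (K * \<nu>) \<le> C / \<nu> * u\<^sup>2"
      using u(3) K \<nu>(2) by (simp add: field_simps)
    then have "sqrt (1 / (K * \<nu>)) \<le> sqrt (C / \<nu> * u\<^sup>2)" by (rule real_sqrt_le_mono)
    then show "1 / sqrt (K * \<nu>) \<le> \<gamma> * u"
      using u(1) by (simp add: \<gamma>_def real_sqrt_mult real_sqrt_divide)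
    have "A - B * \<nu> = 1 - \<gamma> * (?S + ?e * \<theta>)"
      by (simp add: A_def B_def \<theta>_def field_simps)
    then show "q * (1 - u) + u \<le> (A - B * (real m / real (card S))) / 2"
      using bias unfolding \<nu>(1)[symmetric] T_def by (simp add: algebra_simps)
  qed
qed

theorem theorem2p1:
  fixes m d :: nat
    and \<nu> :: real
    and X :: "'x set"
    and H :: "('x \<Rightarrow> int) set"
    and L :: "('x \<times> int) list \<Rightarrow> 'x \<Rightarrow> int"
  assumes "m \<ge> 1" and "d \<ge> 1" and "\<nu> = real m / real d"
    and "finite X"
    and "H \<subseteq> X \<rightarrow>\<^sub>E labels"
    and "has_vc_dim X H d"
    and "L \<in> samples m X \<rightarrow> H"
  shows
    "(\<nu> \<ge> 12.8 \<longrightarrow>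
        (\<exists>D \<in> distributions_on X.
           measure_pmf.prob (replicate_pmf m D)
             {z. excess_risk H (L z) D > 1 / sqrt (320 * \<nu>)} \<ge> 0.238))
     \<and> (\<nu> \<ge> 12.8 \<longrightarrow>
        (\<exists>D \<in> distributions_on X.
           measure_pmf.prob (replicate_pmf m D)
             {z. excess_risk H (L z) D > 1 / sqrt (41.3 * \<nu>)} \<ge> 1 / 64))
     \<and> (\<nu> \<ge> 3 \<longrightarrow>
        (\<exists>D \<in> distributions_on X.
           measure_pmf.prob (replicate_pmf m D)
             {z. excess_risk H (L z) D > 1 / sqrt (320 * \<nu>)} \<ge> 0.227) \<and>
        (\<exists>D \<in> distributions_on X.
           measure_pmf.prob (replicate_pmf m D)
             {z. excess_risk H (L z) D > 1 / sqrt (49.6 * \<nu>)} \<ge> 1 / 64))"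
proof -
  obtain S where S: "S \<subseteq> X" "finite S" "card S = d" "shatters H S"
    using assms(6) by (auto simp: has_vc_dim_def)
  have "S \<noteq> {}" using S(3) assms(2) by auto
  have "finite H"
    by (rule finite_subset[OF assms(5)]) (use assms(4) in \<open>simp add: finite_PiE finite_labels\<close>)
  note bound = excess_risk_lower_bound[OF S(2) \<open>S \<noteq> {}\<close> S(1) \<open>finite H\<close> S(4) assms(7)
      assms(3)[folded S(3)]]
  show ?thesis
  proof (intro conjI impI)
    \<comment> \<open>\<open>C = \<gamma>\<^sup>2 \<nu>\<close> is chosen close to the value that maximises \<open>q = (p - u) / (1 - u)\<close>, where
      \<open>p\<close> is the mean disagreement and \<open>u\<close> is \<open>1 / sqrt (C K)\<close> rounded up.\<close>
    show "\<exists>D \<in> distributions_on X. measure_pmf.prob (replicate_pmf m D)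
        {z. excess_risk H (L z) D > 1 / sqrt (320 * \<nu>)} \<ge> 0.238" if nu: "12.8 \<le> \<nu>"
      by (rule bound[where n = "12.8" and C = "0.33\<^sup>2" and u = "0.1694"];
          (rule rate_inequality[where n = "12.8" and \<mu> = 0])?;
          use nu in \<open>simp add: power2_eq_square\<close>)
    show "\<exists>D \<in> distributions_on X. measure_pmf.prob (replicate_pmf m D)
        {z. excess_risk H (L z) D > 1 / sqrt (41.3 * \<nu>)} \<ge> 1 / 64" if nu: "12.8 \<le> \<nu>"
      by (rule bound[where n = "12.8" and C = "0.68\<^sup>2" and u = "0.22884"];
          (rule rate_inequality[where n = "12.8" and \<mu> = 0])?;
          use nu in \<open>simp add: power2_eq_square\<close>)
    show "\<exists>D \<in> distributions_on X. measure_pmf.prob (replicate_pmf m D)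
        {z. excess_risk H (L z) D > 1 / sqrt (320 * \<nu>)} \<ge> 0.227" if nu: "3 \<le> \<nu>"
      by (rule bound[where n = 3 and C = "0.32\<^sup>2" and u = "0.1747"];
          (rule rate_inequality[where n = 3 and \<mu> = 0])?;
          use nu in \<open>simp add: power2_eq_square\<close>)
    \<comment> \<open>With these constants the rate inequality fails at \<open>\<nu> = 3\<close>,
      \<open>\<theta> = 1\<close>, a corner excluded by \<open>3 + 2 * \<theta> \<le> \<nu>\<close>.
      Taking \<open>\<mu> = 1\<close> moves that end of the line to
      \<open>\<nu> = 4\<close>.\<close>
    show "\<exists>D \<in> distributions_on X. measure_pmf.prob (replicate_pmf m D)
        {z. excess_risk H (L z) D > 1 / sqrt (49.6 * \<nu>)} \<ge> 1 / 64" if nu: "3 \<le> \<nu>"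
      by (rule bound[where n = 3 and C = "0.6\<^sup>2" and u = "0.23666"];
          (rule rate_inequality[where n = 3 and \<mu> = 1])?;
          use nu in \<open>simp add: power2_eq_square\<close>)
  qed
qed

end
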